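(* Let $A\subset\mathbb{R}^n$ be a nonempty finite set and let $f\in D_A$ be an exponential sum in the DSONC cone whose coefficient at every vertex of $\mathrm{conv}(A)$ is positive. Then $f\notin\partial S_A$, where $\partial S_A$ is the boundary of the SONC cone $S_A$ in $\mathbb{R}^A$. In particular, $f(x)>0$ for all $x\in\mathbb{R}^n$, i.e. $f$ has no real zeros.
   Context: For a finite set $A\subset\mathbb{R}^n$, $\mathbb{R}^A$ denotes the real vector space of exponential sums $f(x)=\sum_{\alpha\in A}c_\alpha e^{\langle x,\alpha\rangle}$, $x\in\mathbb{R}^n$, with $c_\alpha\in\mathbb{R}$; it is identified with $\mathbb{R}^{\#A}$ (with its usual topology) via the coefficient vector. A (simplicial) circuit is either a single point, or a set $C=C^+\cup\{\beta\}\subset\mathbb{R}^n$ where $C^+$ is a finite affinely independent set with at least two points and $\beta$ is in the relative interior of the simplex $\mathrm{conv}(C^+)$. A circuit function supported on a circuit $C$ is an exponential sum with support $C$ whose coefficients at the vertices of $\mathrm{conv}(C)$ are positive (the coefficient at the inner point, if there is one, may have any sign). SONC cone: $S_A\subset\mathbb{R}^A$ is the convex cone of all finite sums of circuit functions with support contained in $A$ that are nonnegative on $\mathbb{R}^n$ (including the empty sum $0$). For $A^+\subset\mathbb{R}^n$ finite and $\beta\in\mathbb{R}^n$ let $\Lambda(A^+,\beta)=\{\lambda\in\mathbb{R}_{\ge0}^{A^+}:\sum_{\alpha\in A^+}\lambda_\alpha\alpha=\beta,\ \sum_{\alpha\in A^+}\lambda_\alpha=1\}$. For $\beta\in\mathrm{conv}(A^+)\setminus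 A^+$ let $D_{A^+,\beta}$ be the set of all $f(x)=\sum_{\alpha\in A^+}c_\alpha e^{\langle x,\alpha\rangle}+c_\beta e^{\langle x,\beta\rangle}$ with $c_\alpha\ge0$ for all $\alpha\in A^+$ and such that either $c_\beta\ge0$, or $|c_\beta|\le\prod_{\alpha\in A^+}c_\alpha^{\lambda_\alpha}$ for all $\lambda\in\Lambda(A^+,\beta)$ (convention $0^0=1$). DSONC cone: $D_A\subset\mathbb{R}^A$ is the convex cone generated by the exponential monomials $e^{\langle x,\alpha\rangle}$, $\alpha\in A$, together with all sets $D_{A^+,\beta}$ where $A^+\subseteq A$ and $\beta\in A\setminus A^+$ with $\beta\in\mathrm{conv}(A^+)$. *)

theory Defs
  imports "HOL-Analysis.Analysis"
begin

text \<open>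
  An exponential sum is represented by its coefficient function \<open>c\<close>; the space of exponential
  sums with exponents in \<open>A\<close> is thus the set of functions vanishing outside \<open>A\<close>. Functions carry
  the topology of pointwise convergence, so for finite \<open>A\<close> the subspace topology
  \<open>top_of_set (exp_space A)\<close> is the usual topology on the coefficient vectors.
\<close>

definition exp_space :: "(real^'n) set \<Rightarrow> ((real^'n) \<Rightarrow> real) set" where
  "exp_space A = {c. \<forall>\<alpha>. \<alpha> \<notin> A \<longrightarrow> c \<alpha> = 0}"

definition exp_sum :: "(real^'n) set \<Rightarrow> ((real^'n) \<Rightarrow> real) \<Rightarrow> (real^'n) \<Rightarrow> real" where
  "exp_sum A c x = (\<Sum>\<alpha>\<in>A. c \<alpha> * exp (x \<bullet> \<alpha>))"

definition circuit :: "(real^'n) set \<Rightarrow> bool" where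
  "circuit C \<longleftrightarrow>
     (\<exists>\<alpha>. C = {\<alpha>}) \<or>
     (\<exists>Cp \<beta>. C = insert \<beta> Cp \<and> finite Cp \<and> \<not> affine_dependent Cp \<and> 2 \<le> card Cp \<and>
             \<beta> \<in> rel_interior (convex hull Cp))"

definition circuit_functions :: "(real^'n) set \<Rightarrow> ((real^'n) \<Rightarrow> real) set" where
  "circuit_functions C =
     {c. {\<alpha>. c \<alpha> \<noteq> 0} = C \<and> (\<forall>v. v extreme_point_of (convex hull C) \<longrightarrow> 0 < c v)}"

definition nonneg_circuit_functions :: "(real^'n) set \<Rightarrow> ((real^'n) \<Rightarrow> real) set" where
  "nonneg_circuit_functions A =
     {c. \<exists>C. C \<subseteq> A \<and> circuit C \<and> c \<in> circuit_functions C \<and> (\<forall>x. 0 \<le> exp_sum C c x)}"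

definition SONC :: "(real^'n) set \<Rightarrow> ((real^'n) \<Rightarrow> real) set" where
  "SONC A = {f. \<exists>(m::nat) g. (\<forall>i<m. g i \<in> nonneg_circuit_functions A) \<and>
                             f = (\<lambda>\<alpha>. \<Sum>i<m. g i \<alpha>)}"

definition bary_weights :: "(real^'n) set \<Rightarrow> (real^'n) \<Rightarrow> ((real^'n) \<Rightarrow> real) set" where
  "bary_weights Ap \<beta> =
     {l \<in> exp_space Ap. (\<forall>\<alpha>\<in>Ap. 0 \<le> l \<alpha>) \<and>
        (\<Sum>\<alpha>\<in>Ap. l \<alpha> *\<^sub>R \<alpha>) = \<beta> \<and> (\<Sum>\<alpha>\<in>Ap. l \<alpha>) = 1}"

text \<open>Real powers of nonnegative bases with \<open>0\<^sup>0 = 1\<close>; note that \<open>0 powr 0 = 0\<close>.\<close>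

definition rpow :: "real \<Rightarrow> real \<Rightarrow> real" where
  "rpow x y = (if y = 0 then 1 else x powr y)"

definition D_set :: "(real^'n) set \<Rightarrow> (real^'n) \<Rightarrow> ((real^'n) \<Rightarrow> real) set" where
  "D_set Ap \<beta> =
     {c \<in> exp_space (insert \<beta> Ap). (\<forall>\<alpha>\<in>Ap. 0 \<le> c \<alpha>) \<and>
        (0 \<le> c \<beta> \<or> (\<forall>l\<in>bary_weights Ap \<beta>. \<bar>c \<beta>\<bar> \<le> (\<Prod>\<alpha>\<in>Ap. rpow (c \<alpha>) (l \<alpha>))))}"

definition exp_monomial :: "(real^'n) \<Rightarrow> ((real^'n) \<Rightarrow> real)" where
  "exp_monomial \<alpha> = (\<lambda>\<gamma>. if \<gamma> = \<alpha> then 1 else 0)"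

definition DSONC_generators :: "(real^'n) set \<Rightarrow> ((real^'n) \<Rightarrow> real) set" where
  "DSONC_generators A =
     exp_monomial ` A \<union>
     \<Union> {D_set Ap \<beta> | Ap \<beta>. Ap \<subseteq> A \<and> \<beta> \<in> A - Ap \<and> \<beta> \<in> convex hull Ap}"

definition convex_cone_gen :: "((real^'n) \<Rightarrow> real) set \<Rightarrow> ((real^'n) \<Rightarrow> real) set" where
  "convex_cone_gen G = {f. \<exists>(m::nat) t g. (\<forall>i<m. 0 \<le> t i \<and> g i \<in> G) \<and>
                                          f = (\<lambda>\<alpha>. \<Sum>i<m. t i * g i \<alpha>)}"

definition DSONC :: "(real^'n) set \<Rightarrow> ((real^'n) \<Rightarrow> real) set" where
  "DSONC A = convex_cone_gen (DSONC_generators A)"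

end

theory Submission
  imports Defs
begin

text \<open>
  A nonnegative circuit function with inner point \<open>\<beta> = \<Sum> u\<^sub>\<alpha> \<alpha>\<close> may have the inner coefficient
  \<open>- \<Prod> c\<^sub>\<alpha> powr u\<^sub>\<alpha>\<close> already when its outer coefficients are only \<open>u\<^sub>\<alpha> c\<^sub>\<alpha>\<close>, and \<open>u\<^sub>\<alpha> < 1\<close>. Hence every
  generator of the DSONC cone dominates coefficientwise an element of the SONC cone, strictly at
  each positive coefficient. So \<open>f = h + r\<close> with \<open>h\<close> in the SONC cone, \<open>r \<ge> 0\<close> coefficientwise,
  and \<open>r\<close> positive at the vertices of \<open>conv(A)\<close>. A small negative coefficient at a non-vertex can
  be absorbed by the vertices in a nonnegative circuit function, so \<open>r\<close>, and therefore \<open>f\<close>, is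
  interior.
\<close>

section \<open>Weighted AM-GM, barycentric coordinates and circuit functions\<close>

text \<open>Jensen's inequality for \<open>exp\<close> at the points
  \<open>ln (c t) + x \<bullet> t\<close> with weights \<open>u t\<close>. The coefficients on the
  right come out as \<open>u t * c t\<close> rather than \<open>c t\<close>; this factor is the
  source of all slack below.\<close>

lemma weighted_am_gm_exp:
  fixes c :: "(real^'n) \<Rightarrow> real"
  assumes "finite T" "T \<noteq> {}" and pos: "\<And>t. t \<in> T \<Longrightarrow> 0 < u t \<and> 0 < c t"
    and "sum u T = 1" and bary: "(\<Sum>t\<in>T. u t *\<^sub>R t) = \<beta>"
  shows "(\<Prod>t\<in>T. c t powr u t) * exp (x \<bullet> \<beta>) \<le> (\<Sum>t\<in>T. u t * c t * exp (x \<bullet> t))"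
proof -
  have "(\<Prod>t\<in>T. c t powr u t) * exp (x \<bullet> \<beta>) = exp (\<Sum>t\<in>T. u t *\<^sub>R (ln (c t) + x \<bullet> t))"
  proof -
    have "(\<Prod>t\<in>T. c t powr u t) = exp (\<Sum>t\<in>T. u t * ln (c t))"
      unfolding exp_sum[OF \<open>finite T\<close>] using pos by (intro prod.cong) (force simp: powr_def)+
    moreover have "x \<bullet> \<beta> = (\<Sum>t\<in>T. u t * (x \<bullet> t))"
      unfolding bary[symmetric] by (simp add: inner_sum_right)
    ultimately show ?thesis
      by (simp add: exp_add[symmetric] sum.distrib[symmetric] algebra_simps)
  qed
  also have "\<dots> \<le> (\<Sum>t\<in>T. u t * exp (ln (c t) + x \<bullet> t))"
    using pos by (intro convex_on_sum[OF assms(1,2) exp_convex assms(4)]) (auto intro: less_imp_le)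
  also have "\<dots> = (\<Sum>t\<in>T. u t * c t * exp (x \<bullet> t))"
    using pos by (intro sum.cong) (auto simp: exp_add)
  finally show ?thesis .
qed

text \<open>Take \<open>T\<close> of least cardinality with \<open>x\<close> in its hull.
  Caratheodory's theorem inside \<open>T\<close> bounds \<open>card T\<close> by
  \<open>aff_dim T + 1\<close>, which forces affine independence. A point of weight 0 could be
  dropped, against minimality, so all weights are positive.\<close>

lemma convex_hull_simplicial_subset:
  fixes S :: "'a::euclidean_space set"
  assumes "finite S" "x \<in> convex hull S"
  obtains T u where "T \<subseteq> S" "\<not> affine_dependent T" "\<And>t. t \<in> T \<Longrightarrow> 0 < u t"
    "sum u T = 1" "(\<Sum>t\<in>T. u t *\<^sub>R t) = x"
proof -
  obtain T where T: "T \<subseteq> S" "x \<in> convex hull T"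
    and min: "\<And>T'. T' \<subseteq> S \<Longrightarrow> x \<in> convex hull T' \<Longrightarrow> card T \<le> card T'"
    using assms
      ex_has_least_nat[of "\<lambda>T. T \<subseteq> S \<and> x \<in> convex hull T" S card] by auto
  have fin: "finite T"
    using T assms finite_subset by blast
  obtain T' where "T' \<subseteq> T" "int (card T') \<le> aff_dim T + 1" "x \<in> convex hull T'"
    using T(2) unfolding caratheodory_aff_dim[of T] by auto
  then have "int (card T) \<le> aff_dim T + 1"
    using min[of T'] T(1) by force
  then have indep: "\<not> affine_dependent T"
    using aff_dim_le_card[OF fin] fin by (auto simp: affine_independent_iff_card)
  obtain u where u: "\<And>t. t \<in> T \<Longrightarrow> 0 \<le> u t" "sum u T = 1" "(\<Sum>t\<in>T. u t *\<^sub>R t) = x"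
    using T(2) unfolding convex_hull_finite[OF fin] by auto
  have "u t \<noteq> 0" if "t \<in> T" for t
  proof
    assume "u t = 0"
    then have "sum u (T - {t}) = 1" "(\<Sum>s\<in>T - {t}. u s *\<^sub>R s) = x"
      using u(2,3) that fin by (simp_all add: sum_diff1)
    then have "x \<in> convex hull (T - {t})"
      using u(1) fin by (auto simp: convex_hull_finite)
    then have "card T \<le> card (T - {t})"
      using T(1) by (intro min) auto
    then show False
      using card_Diff1_less[OF fin that] by simp
  qed
  then have "0 < u t" if "t \<in> T" for t
    using u(1)[OF that] that by (simp add: less_le)
  with T(1) indep u(2,3) show thesis
    using that by blast
qed

lemma positive_weight_less_1:
  fixes u :: "'a \<Rightarrow> real"
  assumes "finite T" "\<And>t. t \<in> T \<Longrightarrow> 0 < u t" "sum u T = 1" "2 \<le> card T" "t \<in> T"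
  shows "u t < 1"
proof -
  have "T - {t} \<noteq> {}"
    using card_mono[of "{t}" T] assms(4) by auto
  then have "0 < sum u (T - {t})"
    using assms by (intro sum_pos) auto
  then show ?thesis
    using assms by (simp add: sum_diff1)
qed

text \<open>The empty set cannot carry total weight 1, and a singleton would consist of
  \<open>\<beta>\<close> itself. Two points are what a circuit requires and what keeps every single
  weight below 1.\<close>

lemma card_ge_2_if_barycenter_notin:
  fixes u :: "'a::real_vector \<Rightarrow> real"
  assumes "finite T" "sum u T = 1" "(\<Sum>t\<in>T. u t *\<^sub>R t) = \<beta>" "\<beta> \<notin> T"
  shows "2 \<le> card T"
proof (rule ccontr)
  assume "\<not> 2 \<le> card T"
  then have "card T = 0 \<or> card T = 1"
    by linarith
  then show False
    using assms by (auto simp: card_1_singleton_iff)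
qed

text \<open>Positive weights on an affinely independent set place \<open>\<beta>\<close> in the
  relative interior of the simplex, and weighted AM-GM bounds the inner term by the outer ones. With
  \<open>0 < b\<close> the support is all of \<open>insert \<beta> T\<close>.\<close>

lemma circuit_function_nonneg:
  fixes c :: "(real^'n) \<Rightarrow> real"
  assumes "T \<subseteq> A" "\<beta> \<in> A" "\<beta> \<notin> T" and indep: "\<not> affine_dependent T"
    and pos: "\<And>t. t \<in> T \<Longrightarrow> 0 < u t \<and> 0 < c t"
    and u1: "sum u T = 1" and bary: "(\<Sum>t\<in>T. u t *\<^sub>R t) = \<beta>"
    and b: "0 < b" "b \<le> (\<Prod>t\<in>T. c t powr u t)"
  shows "(\<lambda>\<alpha>. if \<alpha> = \<beta> then - b else if \<alpha> \<in> T then u \<alpha> * c \<alpha> else 0)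
           \<in> nonneg_circuit_functions A" (is "?g \<in> _")
proof -
  have fin: "finite T"
    using indep by (rule aff_independent_finite)
  have card2: "2 \<le> card T"
    using card_ge_2_if_barycenter_notin fin u1 bary \<open>\<beta> \<notin> T\<close> by blast
  have ri: "\<beta> \<in> rel_interior (convex hull T)"
    unfolding rel_interior_convex_hull_explicit[OF indep] using pos u1 bary by blast
  \<comment> \<open>The inner point adds nothing to the hull, so the vertices of the circuit lie in
    \<open>T\<close>, where the coefficients are positive.\<close>
  have hull: "convex hull insert \<beta> T = convex hull T"
    using ri rel_interior_subset by (metis hull_redundant subsetD)
  have "circuit (insert \<beta> T)"
    unfolding circuit_def using fin indep card2 ri by blast
  moreover have "?g \<in> circuit_functions (insert \<beta> T)"
    unfolding circuit_functions_def mem_Collect_eq hull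
  proof (intro conjI allI impI)
    show "{\<alpha>. ?g \<alpha> \<noteq> 0} = insert \<beta> T"
      using pos b \<open>\<beta> \<notin> T\<close> by (fastforce split: if_splits)
    show "0 < ?g v" if "v extreme_point_of convex hull T" for v
      using extreme_point_of_convex_hull[OF that] pos \<open>\<beta> \<notin> T\<close> by auto
  qed
  moreover have "0 \<le> exp_sum (insert \<beta> T) ?g x" for x
  proof -
    have "b * exp (x \<bullet> \<beta>) \<le> (\<Prod>t\<in>T. c t powr u t) * exp (x \<bullet> \<beta>)"
      using b by simp
    also have "\<dots> \<le> (\<Sum>t\<in>T. u t * c t * exp (x \<bullet> t))"
      using card2 by (intro weighted_am_gm_exp fin pos u1 bary) auto
    also have "\<dots> = (\<Sum>t\<in>T. ?g t * exp (x \<bullet> t))"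
      using \<open>\<beta> \<notin> T\<close> by (intro sum.cong) auto
    finally show ?thesis
      unfolding exp_sum_def using fin \<open>\<beta> \<notin> T\<close> by simp
  qed
  ultimately show ?thesis
    unfolding nonneg_circuit_functions_def using assms(1,2) by blast
qed

section \<open>Cone operations and order properties of the SONC cone\<close>

lemma zero_in_SONC: "(\<lambda>_. 0) \<in> SONC A"
  unfolding SONC_def by (intro CollectI exI[of _ 0]) auto

lemma SONC_add_circuit:
  assumes "h \<in> SONC A" "g \<in> nonneg_circuit_functions A"
  shows "(\<lambda>\<alpha>. h \<alpha> + g \<alpha>) \<in> SONC A"
proof -
  obtain m :: nat and k where "\<forall>i<m. k i \<in> nonneg_circuit_functions A" "h = (\<lambda>\<alpha>. \<Sum>i<m. k i \<alpha>)"
    using assms(1) unfolding SONC_def by blast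
  then show ?thesis
    unfolding SONC_def using assms(2)
    by (intro CollectI exI[of _ "Suc m"] exI[of _ "k(m := g)"]) (auto simp: less_Suc_eq)
qed

lemma nonneg_circuit_functions_SONC: "g \<in> nonneg_circuit_functions A \<Longrightarrow> g \<in> SONC A"
  using SONC_add_circuit[OF zero_in_SONC] by auto

lemma SONC_add:
  assumes "f \<in> SONC A" "h \<in> SONC A"
  shows "(\<lambda>\<alpha>. f \<alpha> + h \<alpha>) \<in> SONC A"
proof -
  have "(\<lambda>\<alpha>. f \<alpha> + (\<Sum>i<m. k i \<alpha>)) \<in> SONC A"
    if "\<forall>i<m. k i \<in> nonneg_circuit_functions A" for m :: nat and k
    using that
  proof (induction m)
    case (Suc m)
    then have "(\<lambda>\<alpha>. f \<alpha> + (\<Sum>i<m. k i \<alpha>)) \<in> SONC A" "k m \<in> nonneg_circuit_functions A"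
      by simp_all
    from SONC_add_circuit[OF this] show ?case
      by (simp add: add.assoc)
  qed (use assms in auto)
  then show ?thesis
    using assms(2) unfolding SONC_def by auto
qed

lemma SONC_sum:
  assumes "finite I" "\<And>i. i \<in> I \<Longrightarrow> h i \<in> SONC A"
  shows "(\<lambda>\<alpha>. \<Sum>i\<in>I. h i \<alpha>) \<in> SONC A"
  using assms by (induction I rule: finite_induct) (auto intro: SONC_add zero_in_SONC)

text \<open>A positive factor keeps the support equal to the circuit; the factor 0 would empty
  it.\<close>

lemma nonneg_circuit_functions_scale:
  assumes "g \<in> nonneg_circuit_functions A" "0 < (t::real)"
  shows "(\<lambda>\<alpha>. t * g \<alpha>) \<in> nonneg_circuit_functions A"
proof -
  obtain C where C: "C \<subseteq> A" "circuit C" "g \<in> circuit_functions C" "\<And>x. 0 \<le> exp_sum C g x"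
    using assms(1) unfolding nonneg_circuit_functions_def by auto
  have "exp_sum C (\<lambda>\<alpha>. t * g \<alpha>) x = t * exp_sum C g x" for x
    by (simp add: exp_sum_def sum_distrib_left mult.assoc)
  then show ?thesis
    using C assms(2) unfolding nonneg_circuit_functions_def
    by (intro CollectI exI[of _ C]) (auto simp: circuit_functions_def)
qed

lemma SONC_scale:
  assumes "h \<in> SONC A" "0 \<le> (t::real)"
  shows "(\<lambda>\<alpha>. t * h \<alpha>) \<in> SONC A"
proof (cases "t = 0")
  \<comment> \<open>The zero function has empty support and is no circuit function; it enters the
    cone as the empty sum.\<close>
  case True
  then show ?thesis
    by (simp add: zero_in_SONC)
next
  case False
  obtain m :: nat and k where "\<forall>i<m. k i \<in> nonneg_circuit_functions A" "h = (\<lambda>\<alpha>. \<Sum>i<m. k i \<alpha>)"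
    using assms(1) unfolding SONC_def by blast
  then show ?thesis
    unfolding SONC_def using assms(2) False
    by (intro CollectI exI[of _ m] exI[of _ "\<lambda>i \<alpha>. t * k i \<alpha>"])
      (auto simp: sum_distrib_left intro: nonneg_circuit_functions_scale)
qed

lemma exp_monomial_SONC:
  assumes "\<alpha> \<in> A"
  shows "exp_monomial \<alpha> \<in> SONC A"
proof (rule nonneg_circuit_functions_SONC)
  have "{\<alpha>} \<subseteq> A" "circuit {\<alpha>}" "exp_monomial \<alpha> \<in> circuit_functions {\<alpha>}"
    "\<forall>x. 0 \<le> exp_sum {\<alpha>} (exp_monomial \<alpha>) x"
    using assms by (auto simp: circuit_def circuit_functions_def exp_monomial_def exp_sum_def
        dest: extreme_point_of_convex_hull)
  then show "exp_monomial \<alpha> \<in> nonneg_circuit_functions A"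
    unfolding nonneg_circuit_functions_def by blast
qed

lemma SONC_subset_exp_space: "SONC A \<subseteq> exp_space A"
proof
  fix h assume "h \<in> SONC A"
  then obtain m :: nat and k where k: "\<forall>i<m. k i \<in> nonneg_circuit_functions A" "h = (\<lambda>\<alpha>. \<Sum>i<m. k i \<alpha>)"
    unfolding SONC_def by blast
  have "k i \<alpha> = 0" if "i < m" "\<alpha> \<notin> A" for i \<alpha>
    using k(1) that unfolding nonneg_circuit_functions_def circuit_functions_def by blast
  then show "h \<in> exp_space A"
    using k(2) by (auto simp: exp_space_def)
qed

lemma nonneg_coeffs_SONC:
  assumes "finite A" "r \<in> exp_space A" "\<And>\<alpha>. 0 \<le> r \<alpha>"
  shows "r \<in> SONC A"
proof -
  have "(\<lambda>\<gamma>. \<Sum>\<alpha>\<in>A. r \<alpha> * exp_monomial \<alpha> \<gamma>) \<in> SONC A"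
    using assms by (intro SONC_sum SONC_scale exp_monomial_SONC)
  also have "(\<lambda>\<gamma>. \<Sum>\<alpha>\<in>A. r \<alpha> * exp_monomial \<alpha> \<gamma>) = r"
    using assms(1,2) by (auto simp: exp_monomial_def exp_space_def fun_eq_iff if_distrib cong: if_cong)
  finally show ?thesis .
qed

text \<open>The difference \<open>f - h\<close> has nonnegative coefficients, so it is a nonnegative
  combination of monomials, each a circuit function on a single point. Membership in the cone thus
  reduces to finding a member below.\<close>

lemma SONC_dominating:
  assumes "finite A" "h \<in> SONC A" "f \<in> exp_space A" "\<And>\<alpha>. h \<alpha> \<le> f \<alpha>"
  shows "f \<in> SONC A"
proof -
  have "(\<lambda>\<alpha>. h \<alpha> + (f \<alpha> - h \<alpha>)) \<in> SONC A"
  proof (rule SONC_add[OF assms(2)], rule nonneg_coeffs_SONC[OF assms(1)])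
    show "(\<lambda>\<alpha>. f \<alpha> - h \<alpha>) \<in> exp_space A"
      using assms(2,3) SONC_subset_exp_space[of A] by (auto simp: exp_space_def)
  qed (use assms(4) in simp)
  then show ?thesis
    by simp
qed

lemma SONC_exp_sum_nonneg:
  assumes "finite A" "h \<in> SONC A"
  shows "0 \<le> exp_sum A h x"
proof -
  obtain m :: nat and k where k: "\<forall>i<m. k i \<in> nonneg_circuit_functions A" "h = (\<lambda>\<alpha>. \<Sum>i<m. k i \<alpha>)"
    using assms(2) unfolding SONC_def by blast
  have "0 \<le> exp_sum A (k i) x" if i: "i < m" for i
  proof -
    obtain C where C: "C \<subseteq> A" "k i \<in> circuit_functions C" "0 \<le> exp_sum C (k i) x"
      using k(1) i unfolding nonneg_circuit_functions_def by blast
    then have "exp_sum A (k i) x = exp_sum C (k i) x"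
      unfolding exp_sum_def circuit_functions_def
      using assms(1) by (intro sum.mono_neutral_right) auto
    with C(3) show ?thesis
      by simp
  qed
  moreover have "exp_sum A h x = (\<Sum>i<m. exp_sum A (k i) x)"
    unfolding k(2) exp_sum_def sum_distrib_right by (rule sum.swap)
  ultimately show ?thesis
    by (metis lessThan_iff sum_nonneg)
qed

section \<open>Comparison of the DSONC cone with the SONC cone\<close>

text \<open>If \<open>c \<beta>\<close> is nonnegative, \<open>h = 0\<close> serves. Otherwise the
  weight supported on a simplex \<open>T\<close> around \<open>\<beta>\<close> yields a circuit
  function with the same inner coefficient and outer coefficients \<open>u t * c t\<close>, leaving
  \<open>(1 - u t) * c t\<close> over on \<open>T\<close> and all of \<open>c\<close> on the rest of
  \<open>Ap\<close>.\<close>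

lemma D_set_dominates_SONC:
  assumes "finite A" "Ap \<subseteq> A" "\<beta> \<in> A - Ap" "\<beta> \<in> convex hull Ap" "c \<in> D_set Ap \<beta>"
  obtains h where "h \<in> SONC A" "\<And>\<alpha>. h \<alpha> \<le> c \<alpha>" "\<And>\<alpha>. 0 < c \<alpha> \<Longrightarrow> h \<alpha> < c \<alpha>"
proof (cases "0 \<le> c \<beta>")
  case True
  then have "0 \<le> c \<alpha>" for \<alpha>
    using assms(5) by (cases "\<alpha> \<in> insert \<beta> Ap") (auto simp: D_set_def exp_space_def)
  then show thesis
    by (intro that[of "\<lambda>_. 0"] zero_in_SONC)
next
  case neg: False
  have c: "0 \<le> c \<alpha>" if "\<alpha> \<noteq> \<beta>" for \<alpha>
    using assms(5) that by (cases "\<alpha> \<in> Ap") (auto simp: D_set_def exp_space_def)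
  have fin: "finite Ap"
    using assms(1,2) finite_subset by blast
  obtain T u where T: "T \<subseteq> Ap" "\<not> affine_dependent T" "\<And>t. t \<in> T \<Longrightarrow> 0 < u t"
    "sum u T = 1" "(\<Sum>t\<in>T. u t *\<^sub>R t) = \<beta>"
    by (rule convex_hull_simplicial_subset[OF fin assms(4)]) (rule that)
  have finT: "finite T" and \<beta>T: "\<beta> \<notin> T"
    using T(1) fin finite_subset assms(3) by auto
  \<comment> \<open>Extension of \<open>u\<close> by zero to a weight on \<open>Ap\<close>. By the
    convention for \<open>rpow\<close>, the points outside \<open>T\<close> contribute the factor 1
    even where \<open>c\<close> vanishes there.\<close>
  define l where "l = (\<lambda>\<alpha>. if \<alpha> \<in> T then u \<alpha> else 0)"
  have "(\<Sum>\<alpha>\<in>Ap. l \<alpha> *\<^sub>R \<alpha>) = (\<Sum>\<alpha>\<in>T. u \<alpha> *\<^sub>R \<alpha>)" "(\<Sum>\<alpha>\<in>Ap. l \<alpha>) = sum u T"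
    unfolding l_def by (rule sum.mono_neutral_cong_right[OF fin T(1)]; simp)+
  then have "l \<in> bary_weights Ap \<beta>"
    unfolding bary_weights_def exp_space_def using T
    by (auto simp: l_def less_imp_le)
  then have "- c \<beta> \<le> (\<Prod>\<alpha>\<in>Ap. rpow (c \<alpha>) (l \<alpha>))"
    using assms(5) neg unfolding D_set_def by fastforce
  also have "\<dots> = (\<Prod>\<alpha>\<in>T. c \<alpha> powr u \<alpha>)"
  proof (rule prod.mono_neutral_cong_right[OF fin T(1)])
    show "\<forall>\<alpha>\<in>Ap - T. rpow (c \<alpha>) (l \<alpha>) = 1"
      by (simp add: rpow_def l_def)
    show "rpow (c \<alpha>) (l \<alpha>) = c \<alpha> powr u \<alpha>" if "\<alpha> \<in> T" for \<alpha>
      using T(3)[OF that] that by (simp add: rpow_def l_def)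
  qed
  finally have le: "- c \<beta> \<le> (\<Prod>\<alpha>\<in>T. c \<alpha> powr u \<alpha>)" .
  \<comment> \<open>A zero coefficient on \<open>T\<close> would annihilate the product, because its
    exponent is positive, and so force \<open>c \<beta>\<close> to be nonnegative.\<close>
  have cpos: "0 < c t" if t: "t \<in> T" for t
  proof -
    have "c t \<noteq> 0"
    proof
      assume "c t = 0"
      then have "(\<Prod>\<alpha>\<in>T. c \<alpha> powr u \<alpha>) = 0"
        using t finT by (intro prod_zero) auto
      then show False
        using le neg by simp
    qed
    then show ?thesis
      using c[of t] t \<beta>T by force
  qed
  \<comment> \<open>The double negation matches the form of \<open>circuit_function_nonneg\<close>
    with \<open>b = - c \<beta>\<close>.\<close>
  define h where "h = (\<lambda>\<alpha>. if \<alpha> = \<beta> then - (- c \<beta>) else if \<alpha> \<in> T then u \<alpha> * c \<alpha> else 0)"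
  have lt: "u t * c t < c t" if "t \<in> T" for t
    using positive_weight_less_1[OF finT T(3,4) _ that] card_ge_2_if_barycenter_notin[OF finT T(4,5) \<beta>T]
      cpos[OF that] by simp
  show thesis
  proof (rule that)
    show "h \<in> SONC A"
      unfolding h_def
      by (intro nonneg_circuit_functions_SONC circuit_function_nonneg)
        (use T assms(2,3) \<beta>T cpos neg le in auto)
    show "h \<alpha> \<le> c \<alpha>" for \<alpha>
      using lt[of \<alpha>] c[of \<alpha>] by (auto simp: h_def)
    show "h \<alpha> < c \<alpha>" if "0 < c \<alpha>" for \<alpha>
      using lt[of \<alpha>] that neg by (auto simp: h_def)
  qed
qed

lemma DSONC_generator_dominates_SONC:
  assumes "finite A" "g \<in> DSONC_generators A"
  obtains h where "h \<in> SONC A" "\<And>\<alpha>. h \<alpha> \<le> g \<alpha>" "\<And>\<alpha>. 0 < g \<alpha> \<Longrightarrow> h \<alpha> < g \<alpha>"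
proof -
  consider \<alpha> where "\<alpha> \<in> A" "g = exp_monomial \<alpha>"
    | Ap \<beta> where "Ap \<subseteq> A" "\<beta> \<in> A - Ap" "\<beta> \<in> convex hull Ap" "g \<in> D_set Ap \<beta>"
    using assms(2) unfolding DSONC_generators_def by auto
  then show thesis
  proof cases
    case 1
    then show thesis
      by (intro that[of "\<lambda>_. 0"] zero_in_SONC) (auto simp: exp_monomial_def)
  next
    case 2
    then show thesis
      by (rule D_set_dominates_SONC[OF assms(1)]) (rule that)
  qed
qed

text \<open>The bounds for the generators are combined with the same factors \<open>t i\<close>.
  Strictness survives at a positive coefficient of \<open>f\<close>, since some summand must be
  positive there.\<close>

lemma DSONC_dominates_SONC:
  assumes "finite A" "f \<in> DSONC A"
  obtains h where "h \<in> SONC A" "\<And>\<alpha>. h \<alpha> \<le> f \<alpha>" "\<And>\<alpha>. 0 < f \<alpha> \<Longrightarrow> h \<alpha> < f \<alpha>"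
proof -
  obtain m :: nat and t g where g: "\<And>i. i < m \<Longrightarrow> 0 \<le> t i" "\<And>i. i < m \<Longrightarrow> g i \<in> DSONC_generators A"
    "f = (\<lambda>\<alpha>. \<Sum>i<m. t i * g i \<alpha>)"
    using assms(2) unfolding DSONC_def convex_cone_gen_def by auto
  have "\<forall>i\<in>{..<m}. \<exists>h. h \<in> SONC A \<and> (\<forall>\<alpha>. h \<alpha> \<le> g i \<alpha>) \<and> (\<forall>\<alpha>. 0 < g i \<alpha> \<longrightarrow> h \<alpha> < g i \<alpha>)"
  proof
    fix i assume "i \<in> {..<m}"
    then have "g i \<in> DSONC_generators A"
      by (simp add: g(2))
    then obtain h where "h \<in> SONC A" "\<And>\<alpha>. h \<alpha> \<le> g i \<alpha>" "\<And>\<alpha>. 0 < g i \<alpha> \<Longrightarrow> h \<alpha> < g i \<alpha>"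
      by (rule DSONC_generator_dominates_SONC[OF assms(1)]) (rule that)
    then show "\<exists>h. h \<in> SONC A \<and> (\<forall>\<alpha>. h \<alpha> \<le> g i \<alpha>) \<and> (\<forall>\<alpha>. 0 < g i \<alpha> \<longrightarrow> h \<alpha> < g i \<alpha>)"
      by (intro exI[of _ h]) simp
  qed
  from bchoice[OF this] obtain h where
    "\<forall>i\<in>{..<m}. h i \<in> SONC A \<and> (\<forall>\<alpha>. h i \<alpha> \<le> g i \<alpha>) \<and> (\<forall>\<alpha>. 0 < g i \<alpha> \<longrightarrow> h i \<alpha> < g i \<alpha>)"
    by (rule exE)
  then have h: "\<And>i. i < m \<Longrightarrow> h i \<in> SONC A" "\<And>i \<alpha>. i < m \<Longrightarrow> h i \<alpha> \<le> g i \<alpha>"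
    "\<And>i \<alpha>. i < m \<Longrightarrow> 0 < g i \<alpha> \<Longrightarrow> h i \<alpha> < g i \<alpha>"
    by simp_all
  show thesis
  proof (rule that)
    show "(\<lambda>\<alpha>. \<Sum>i<m. t i * h i \<alpha>) \<in> SONC A"
      using h(1) g(1) by (intro SONC_sum SONC_scale) auto
    show "(\<Sum>i<m. t i * h i \<alpha>) \<le> f \<alpha>" for \<alpha>
      unfolding g(3) using h(2) g(1) by (intro sum_mono mult_left_mono) auto
    show "(\<Sum>i<m. t i * h i \<alpha>) < f \<alpha>" if "0 < f \<alpha>" for \<alpha>
    proof -
      have "\<not> (\<forall>i\<in>{..<m}. t i * g i \<alpha> \<le> 0)"
        using that sum_nonpos[of "{..<m}" "\<lambda>i. t i * g i \<alpha>"] unfolding g(3) by force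
      then obtain i where i: "i < m" "0 < t i * g i \<alpha>"
        by (auto simp: not_le)
      then have "0 < t i" "0 < g i \<alpha>"
        using g(1)[OF i(1)] by (simp_all add: zero_less_mult_iff)
      then have "t i * h i \<alpha> < t i * g i \<alpha>"
        using h(3)[OF i(1)] by (simp add: mult_strict_left_mono)
      moreover have "\<forall>j\<in>{..<m}. t j * h j \<alpha> \<le> t j * g j \<alpha>"
        using h(2) g(1) by (simp add: mult_left_mono)
      ultimately show ?thesis
        unfolding g(3) using i(1) by (intro sum_strict_mono_ex1) auto
    qed
  qed
qed

lemma DSONC_subset_exp_space: "DSONC A \<subseteq> exp_space A"
proof
  fix f assume "f \<in> DSONC A"
  then obtain m :: nat and t g where g: "\<And>i. i < m \<Longrightarrow> g i \<in> DSONC_generators A"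
    "f = (\<lambda>\<alpha>. \<Sum>i<m. t i * g i \<alpha>)"
    unfolding DSONC_def convex_cone_gen_def by auto
  have "D_set Ap \<beta> \<subseteq> exp_space A" if "Ap \<subseteq> A" "\<beta> \<in> A" for Ap \<beta>
    using that by (auto simp: D_set_def exp_space_def)
  then have "k \<in> exp_space A" if "k \<in> DSONC_generators A" for k
    using that unfolding DSONC_generators_def by (auto simp: exp_space_def exp_monomial_def)
  then have "g i \<alpha> = 0" if "i < m" "\<alpha> \<notin> A" for i \<alpha>
    using g(1) that unfolding exp_space_def by blast
  then show "f \<in> exp_space A"
    using g(2) by (auto simp: exp_space_def)
qed

section \<open>Interior points of the SONC cone\<close>

text \<open>By Krein-Milman a non-vertex \<open>\<beta>\<close> lies in the hull of the vertices,
  hence in a simplex \<open>T\<close> of vertices. The circuit function with all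
  \<open>c t = 1\<close> and \<open>b = 1\<close> does the job, as the product of powers is then
  1.\<close>

lemma absorbing_circuit_function:
  fixes A :: "(real^'n) set"
  assumes "finite A" "\<beta> \<in> A" "\<not> \<beta> extreme_point_of (convex hull A)"
  obtains g where "g \<in> SONC A" "g \<beta> = - 1" "\<And>\<alpha>. g \<alpha> \<le> 1"
    "\<And>\<alpha>. \<alpha> \<noteq> \<beta> \<Longrightarrow> 0 < g \<alpha> \<Longrightarrow> \<alpha> extreme_point_of (convex hull A)"
proof -
  define V where "V = {v. v extreme_point_of (convex hull A)}"
  have V: "V \<subseteq> A" "\<beta> \<in> convex hull V"
    using extreme_points_of_convex_hull[of A] hull_inc[OF assms(2), of convex]
    unfolding V_def Krein_Milman_polytope[OF assms(1), symmetric] by simp_all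
  obtain T u where T: "T \<subseteq> V" "\<not> affine_dependent T" "\<And>t. t \<in> T \<Longrightarrow> 0 < u t"
    "sum u T = 1" "(\<Sum>t\<in>T. u t *\<^sub>R t) = \<beta>"
    by (rule convex_hull_simplicial_subset[OF finite_subset[OF V(1) assms(1)] V(2)]) (rule that)
  have finT: "finite T"
    using T(2) by (rule aff_independent_finite)
  have \<beta>T: "\<beta> \<notin> T"
    using T(1) assms(3) by (auto simp: V_def)
  have u1: "u t < 1" if "t \<in> T" for t
    using positive_weight_less_1[OF finT T(3,4) _ that]
      card_ge_2_if_barycenter_notin[OF finT T(4,5) \<beta>T] by simp
  show thesis
  proof (rule that)
    show "(\<lambda>\<alpha>. if \<alpha> = \<beta> then - 1 else if \<alpha> \<in> T then u \<alpha> * 1 else 0) \<in> SONC A"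
      by (intro nonneg_circuit_functions_SONC circuit_function_nonneg)
        (use T V(1) assms(2) \<beta>T in auto)
  qed (use u1 T(1) in \<open>auto simp: V_def less_imp_le split: if_splits\<close>)
qed

text \<open>To \<open>h\<close> is added, for each non-vertex, its absorbing function scaled by the
  deviation of \<open>q\<close> from \<open>f\<close> there. The coefficient \<open>- 1\<close> pays
  for the deviation at that point, the gaps between \<open>h\<close> and \<open>f\<close> at the
  vertices pay for the rest. The sum lies below \<open>q\<close>, so \<open>SONC_dominating\<close>
  applies.\<close>

lemma SONC_absorbs:
  fixes A :: "(real^'n) set"
  assumes "finite A" "h \<in> SONC A" "\<And>\<alpha>. h \<alpha> \<le> f \<alpha>"
    and vert: "\<And>v. v extreme_point_of (convex hull A) \<Longrightarrow> h v < f v"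
  obtains e where "0 < e" "\<And>q. q \<in> exp_space A \<Longrightarrow> (\<And>\<alpha>. \<alpha> \<in> A \<Longrightarrow> \<bar>q \<alpha> - f \<alpha>\<bar> < e) \<Longrightarrow> q \<in> SONC A"
proof -
  define V where "V = {v. v extreme_point_of (convex hull A)}"
  have VA: "V \<subseteq> A"
    using extreme_points_of_convex_hull[of A] by (simp add: V_def)
  then have finV: "finite V"
    using assms(1) finite_subset by blast
  have "\<forall>\<beta>\<in>A - V. \<exists>g. g \<in> SONC A \<and> g \<beta> = - 1 \<and> (\<forall>\<alpha>. g \<alpha> \<le> 1) \<and> (\<forall>\<alpha>. \<alpha> \<noteq> \<beta> \<longrightarrow> 0 < g \<alpha> \<longrightarrow> \<alpha> \<in> V)"
  proof
    fix \<beta> assume "\<beta> \<in> A - V"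
    then have "\<beta> \<in> A" "\<not> \<beta> extreme_point_of (convex hull A)"
      by (auto simp: V_def)
    then obtain g where "g \<in> SONC A" "g \<beta> = - 1" "\<And>\<alpha>. g \<alpha> \<le> 1"
      "\<And>\<alpha>. \<alpha> \<noteq> \<beta> \<Longrightarrow> 0 < g \<alpha> \<Longrightarrow> \<alpha> extreme_point_of (convex hull A)"
      by (rule absorbing_circuit_function[OF assms(1)]) (rule that)
    then show "\<exists>g. g \<in> SONC A \<and> g \<beta> = - 1 \<and> (\<forall>\<alpha>. g \<alpha> \<le> 1) \<and> (\<forall>\<alpha>. \<alpha> \<noteq> \<beta> \<longrightarrow> 0 < g \<alpha> \<longrightarrow> \<alpha> \<in> V)"
      by (intro exI[of _ g]) (simp add: V_def)
  qed
  from bchoice[OF this] obtain g where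
    G: "\<forall>\<beta>\<in>A - V. g \<beta> \<in> SONC A \<and> g \<beta> \<beta> = - 1 \<and> (\<forall>\<alpha>. g \<beta> \<alpha> \<le> 1)
      \<and> (\<forall>\<alpha>. \<alpha> \<noteq> \<beta> \<longrightarrow> 0 < g \<beta> \<alpha> \<longrightarrow> \<alpha> \<in> V)"
    by (rule exE)
  then have g: "\<And>\<beta>. \<beta> \<in> A - V \<Longrightarrow> g \<beta> \<in> SONC A" "\<And>\<beta>. \<beta> \<in> A - V \<Longrightarrow> g \<beta> \<beta> = - 1"
    "\<And>\<beta> \<alpha>. \<beta> \<in> A - V \<Longrightarrow> g \<beta> \<alpha> \<le> 1"
    by simp_all
  \<comment> \<open>At the other non-vertices an absorbing function is never positive, so the
    corrections do not disturb each other.\<close>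
  have g4: "g \<beta> \<alpha> \<le> 0" if "\<beta> \<in> A - V" "\<alpha> \<noteq> \<beta>" "\<alpha> \<notin> V" for \<beta> \<alpha>
    using bspec[OF G that(1)] that(2,3) by (meson not_less)
  \<comment> \<open>The smallest gap at a vertex; the inserted 1 keeps the set nonempty, as
    \<open>Min\<close> requires.\<close>
  define d where "d = Min (insert 1 ((\<lambda>v. f v - h v) ` V))"
  have d: "0 < d" "\<And>v. v \<in> V \<Longrightarrow> d \<le> f v - h v"
    unfolding d_def using finV vert by (auto simp: V_def)
  \<comment> \<open>At a vertex each of the at most \<open>card A\<close> corrections costs at most
    \<open>e\<close>, and the deviation of \<open>q\<close> itself costs one more.\<close>
  define e where "e = d / (1 + card A)"
  have e: "0 < e" "e * (1 + card A) = d"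
    using d(1) by (auto simp: e_def)
  show thesis
  proof (rule that[OF e(1)])
    fix q assume q: "q \<in> exp_space A" and near: "\<And>\<alpha>. \<alpha> \<in> A \<Longrightarrow> \<bar>q \<alpha> - f \<alpha>\<bar> < e"
    define p where "p = (\<lambda>\<alpha>. \<bar>q \<alpha> - f \<alpha>\<bar>)"
    define k where "k = (\<lambda>\<alpha>. h \<alpha> + (\<Sum>\<beta>\<in>A - V. p \<beta> * g \<beta> \<alpha>))"
    have p0: "0 \<le> p \<alpha>" for \<alpha>
      by (simp add: p_def)
    have kS: "k \<in> SONC A"
      unfolding k_def using assms(1,2) g(1) p0 by (intro SONC_add SONC_sum SONC_scale) auto
    moreover have "k \<alpha> \<le> q \<alpha>" for \<alpha>
    proof -
      consider "\<alpha> \<notin> A" | "\<alpha> \<in> V" | "\<alpha> \<in> A - V"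
        by blast
      then show ?thesis
      proof cases
        case 1
        then show ?thesis
          using kS SONC_subset_exp_space[of A] q by (auto simp: exp_space_def)
      next
        case 2
        have "(\<Sum>\<beta>\<in>A - V. p \<beta> * g \<beta> \<alpha>) \<le> (\<Sum>\<beta>\<in>A - V. e * 1)"
        proof (rule sum_mono)
          fix \<beta> assume \<beta>: "\<beta> \<in> A - V"
          have "p \<beta> * g \<beta> \<alpha> \<le> p \<beta> * 1"
            using g(3)[OF \<beta>] p0 by (rule mult_left_mono)
          then show "p \<beta> * g \<beta> \<alpha> \<le> e * 1"
            using near[of \<beta>] \<beta> by (simp add: p_def)
        qed
        also have "\<dots> \<le> e * card A"
          using e(1) card_mono[OF assms(1), of "A - V"] by simp
        finally have "k \<alpha> \<le> h \<alpha> + d - e"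
          using e(2) by (simp add: k_def algebra_simps)
        then show ?thesis
          using d(2)[OF 2] near[of \<alpha>] 2 VA by force
      next
        case 3
        \<comment> \<open>Only the correction belonging to \<open>\<alpha>\<close> is split off; it
          contributes exactly \<open>- p \<alpha>\<close>.\<close>
        have "(\<Sum>\<beta>\<in>A - V - {\<alpha>}. p \<beta> * g \<beta> \<alpha>) \<le> 0"
          using g4[of _ \<alpha>] 3 p0 by (intro sum_nonpos mult_nonneg_nonpos) auto
        then have "k \<alpha> \<le> h \<alpha> - p \<alpha>"
          using 3 assms(1) g(2)[OF 3] sum.remove[of "A - V" \<alpha> "\<lambda>\<beta>. p \<beta> * g \<beta> \<alpha>"]
          by (simp add: k_def)
        then show ?thesis
          using assms(3)[of \<alpha>] unfolding p_def by linarith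
      qed
    qed
    ultimately show "q \<in> SONC A"
      using SONC_dominating[OF assms(1) _ q] by blast
  qed
qed

text \<open>Coordinate evaluations are continuous for pointwise convergence, and finiteness of
  \<open>A\<close> makes the box a finite intersection of open conditions.\<close>

lemma openin_exp_space_box:
  fixes A :: "(real^'n) set"
  assumes "finite A"
  shows "openin (top_of_set (exp_space A)) {q \<in> exp_space A. \<forall>\<alpha>\<in>A. \<bar>q \<alpha> - f \<alpha>\<bar> < e}"
proof -
  have "open {q :: real^'n \<Rightarrow> real. \<bar>q \<alpha> - f \<alpha>\<bar> < e}" for \<alpha>
    by (intro open_Collect_less continuous_on_rabs continuous_on_diff continuous_on_const
        continuous_on_product_coordinates)
  then have "open (\<Inter>\<alpha>\<in>A. {q :: real^'n \<Rightarrow> real. \<bar>q \<alpha> - f \<alpha>\<bar> < e})"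
    using assms by (intro open_INT) auto
  moreover have "{q \<in> exp_space A. \<forall>\<alpha>\<in>A. \<bar>q \<alpha> - f \<alpha>\<bar> < e}
      = exp_space A \<inter> (\<Inter>\<alpha>\<in>A. {q. \<bar>q \<alpha> - f \<alpha>\<bar> < e})"
    by auto
  ultimately show ?thesis
    by (simp add: openin_open_Int)
qed

theorem corollary4p11:
  fixes A :: "(real^'n) set" and f :: "real^'n \<Rightarrow> real"
  assumes "finite A" and "A \<noteq> {}"
    and "f \<in> DSONC A"
    and "\<And>v. v extreme_point_of (convex hull A) \<Longrightarrow> 0 < f v"
  shows "f \<notin> (top_of_set (exp_space A)) frontier_of (SONC A) \<and> (\<forall>x. 0 < exp_sum A f x)"
proof -
  obtain h where h: "h \<in> SONC A" "\<And>\<alpha>. h \<alpha> \<le> f \<alpha>" "\<And>\<alpha>. 0 < f \<alpha> \<Longrightarrow> h \<alpha> < f \<alpha>"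
    using DSONC_dominates_SONC[OF assms(1,3)] by blast
  obtain e where e: "0 < e"
    "\<And>q. q \<in> exp_space A \<Longrightarrow> (\<And>\<alpha>. \<alpha> \<in> A \<Longrightarrow> \<bar>q \<alpha> - f \<alpha>\<bar> < e) \<Longrightarrow> q \<in> SONC A"
    using SONC_absorbs[OF assms(1) h(1,2) h(3)[OF assms(4)]] by blast
  \<comment> \<open>This open box around \<open>f\<close> consists of SONC functions, so
    \<open>f\<close> is interior and hence off the frontier.\<close>
  have "{q \<in> exp_space A. \<forall>\<alpha>\<in>A. \<bar>q \<alpha> - f \<alpha>\<bar> < e} \<subseteq> top_of_set (exp_space A) interior_of SONC A"
    using e(2) by (intro interior_of_maximal openin_exp_space_box assms(1)) auto
  moreover have "f \<in> exp_space A"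
    using assms(3) DSONC_subset_exp_space by blast
  ultimately have "f \<in> top_of_set (exp_space A) interior_of SONC A"
    using e(1) by auto
  moreover have "0 < exp_sum A f x" for x
  proof -
    \<comment> \<open>The sum for \<open>h\<close> is only nonnegative; a vertex, which exists
      because \<open>A\<close> is nonempty, makes the comparison with \<open>f\<close>
      strict.\<close>
    have "{v. v extreme_point_of (convex hull A)} \<noteq> {}"
      using Krein_Milman_polytope[OF assms(1)] assms(2) by (metis convex_hull_eq_empty)
    then obtain v where v: "v extreme_point_of (convex hull A)"
      by blast
    then have "v \<in> A" "h v < f v"
      using extreme_point_of_convex_hull h(3) assms(4) by blast+
    then have "exp_sum A h x < exp_sum A f x"
      unfolding exp_sum_def using assms(1) h(2) by (intro sum_strict_mono_ex1) auto
    then show ?thesis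
      using SONC_exp_sum_nonneg[OF assms(1) h(1), of x] by linarith
  qed
  ultimately show ?thesis
    by (simp add: frontier_of_def)
qed

end
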